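(* Let $m\ge1$ be an integer and let the density $p$ be $m$ times differentiable on $\mathbb{R}$ with $p^{(m)}$ a function of bounded variation, $\mathbf{V}(p^{(m)})=V_m<\infty$. If $p_n=p_{n,h_n}$ is the sinc estimator with $h_n=h_0n^{-1/(2m-1)}$ for some constant $h_0>0$, then $$\sup_{x\in\mathbb{R}}\mathrm{MSE}(p_n(x))\le\frac1{\pi^2}\Bigl\{\frac{(m+1)^2}{m^2}V_m^{2m/(m+1)}h_0^{2(m-1)}+2\Bigl(V_m^{1/(m+1)}+\frac1mV_m^{m/(m+1)}\Bigr)\frac1{h_0}\Bigr\}n^{-2(m-1)/(2m-1)}.$$
   Context: Let $X_1,\dots,X_n$ be i.i.d. real random variables with probability density $p$. The sinc kernel is $K(x)=\frac{\sin x}{\pi x}$ (with $K(0)=1/\pi$); the sinc estimator with bandwidth $h>0$ is $p_{n,h}(x)=\frac1{nh}\sum_{j=1}^nK\bigl((x-X_j)/h\bigr)$, equivalently $p_{n,h}(x)=\frac1{2\pi}\int_{-1/h}^{1/h}e^{-itx}f_n(t)\,dt$ with $f_n(t)=\frac1n\sum_{j=1}^ne^{itX_j}$. Define $\mathrm{MSE}(p_{n,h}(x))=\mathrm{E}\{p_{n,h}(x)-p(x)\}^2$. $\mathbf{V}(g)$ is the total variation of $g$ over the whole real line. *)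

theory Defs
  imports "HOL-Probability.Probability"
begin

text \<open>
  Supremum of \<open>\<Sum>i<N. \<bar>g (t (i + 1)) - g (t i)\<bar>\<close> over all finite chains \<open>t 0 < \<dots> < t N\<close> of reals;
  it is \<open>\<infinity>\<close> if \<open>g\<close> is not of bounded variation.
\<close>
definition total_variation :: "(real \<Rightarrow> real) \<Rightarrow> ennreal" where
  "total_variation g =
     (SUP (N, t) \<in> {(N :: nat, t :: nat \<Rightarrow> real). strict_mono_on {..N} t}.
        ennreal (\<Sum>i<N. \<bar>g (t (Suc i)) - g (t i)\<bar>))"

definition times_differentiable :: "nat \<Rightarrow> (real \<Rightarrow> real) \<Rightarrow> bool" where
  "times_differentiable m f \<longleftrightarrow> (\<forall>k<m. \<forall>x. (deriv ^^ k) f differentiable (at x))"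

definition sinc_kernel :: "real \<Rightarrow> real" where
  "sinc_kernel x = (if x = 0 then 1 / pi else sin x / (pi * x))"

text \<open>The sample is \<open>X 1, \<dots>, X n\<close>; the argument \<open>\<omega>\<close> is the point of the sample space.\<close>
definition sinc_estimator ::
    "(nat \<Rightarrow> 'a \<Rightarrow> real) \<Rightarrow> nat \<Rightarrow> real \<Rightarrow> real \<Rightarrow> 'a \<Rightarrow> real" where
  "sinc_estimator X n h x \<omega> =
     1 / (real n * h) * (\<Sum>j = 1..n. sinc_kernel ((x - X j \<omega>) / h))"

text \<open>
  The expectation is a nonnegative integral with values in \<^typ>\<open>ennreal\<close>, so an upper bound on it
  also says that the squared error has finite expectation.
\<close>
definition MSE :: "'a measure \<Rightarrow> ('a \<Rightarrow> real) \<Rightarrow> real \<Rightarrow> ennreal" where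
  "MSE M T \<theta> = (\<integral>\<^sup>+ \<omega>. ennreal ((T \<omega> - \<theta>)\<^sup>2) \<partial>M)"

end

theory Submission
  imports Defs
begin

text \<open>
  Write \<open>\<phi>\<close> for the characteristic function of \<open>p\<close> and \<open>T = V powr (1 / (m + 1))\<close>.
  Taking a forward difference of step \<open>s\<close> multiplies the Fourier transform by \<open>e\<^sup>-\<^sup>i\<^sup>t\<^sup>s - 1\<close>, and the
  \<open>(m + 1)\<close>-fold difference of \<open>p\<close> has \<open>L\<^sup>1\<close>-norm at most \<open>s\<^sup>m\<^sup>+\<^sup>1 V\<close>; letting \<open>s\<close> tend to \<open>0\<close> gives
  \<open>\<bar>\<phi> t\<bar> \<le> V / \<bar>t\<bar>\<^sup>m\<^sup>+\<^sup>1\<close> without any information on the derivatives of \<open>p\<close> at infinity.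
  Together with \<open>\<bar>\<phi>\<bar> \<le> 1\<close> this bounds \<open>\<integral>\<bar>\<phi>\<bar>\<close> by \<open>2 T (1 + 1 / m)\<close>, so the inversion formula holds pointwise and
  \<open>p \<le> T (1 + 1 / m) / \<pi>\<close>. The bias is the part of the inversion integral outside \<open>[-1/h, 1/h]\<close>;
  it is estimated by the decay of \<open>\<phi>\<close> if \<open>T h < 1\<close> and by the whole of \<open>\<integral>\<bar>\<phi>\<bar>\<close> otherwise.
  The variance is at most \<open>sup p \<cdot> \<integral>K\<^sup>2 / (n h)\<close>.
\<close>

subsection \<open>Variation of iterated differences\<close>

definition fdiff :: "real \<Rightarrow> (real \<Rightarrow> real) \<Rightarrow> real \<Rightarrow> real" where
  "fdiff s g = (\<lambda>x. g (x + s) - g x)"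

lemma total_variation_le_iff:
  assumes "V \<ge> 0"
  shows "total_variation g \<le> ennreal V \<longleftrightarrow>
    (\<forall>N t. strict_mono_on {..N} t \<longrightarrow> (\<Sum>i<N. \<bar>g (t (Suc i)) - g (t i)\<bar>) \<le> V)"
  using assms unfolding total_variation_def by (auto simp: SUP_le_iff ennreal_le_iff)

text \<open>Heuristically \<open>fdiff s g x\<close> integrates \<open>deriv g\<close> over a window
  of length \<open>s\<close>, and all translates of \<open>deriv g\<close> have the same variation.
  Differencing thus trades one derivative for a factor \<open>s\<close>.\<close>

lemma total_variation_fdiff_le:
  assumes der: "\<And>x. g differentiable (at x)" and tv: "total_variation (deriv g) \<le> ennreal V"
    and "V \<ge> 0" and "s > 0"
  shows "total_variation (fdiff s g) \<le> ennreal (s * V)"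
proof -
  have D: "(g has_real_derivative deriv g x) (at x)" for x
    using der[of x] by (simp add: DERIV_deriv_iff_real_differentiable)
  have "(\<Sum>i<N. \<bar>fdiff s g (t (Suc i)) - fdiff s g (t i)\<bar>) \<le> s * V"
    if t: "strict_mono_on {..N} t" for N t
  proof -
    \<comment> \<open>The mean value theorem for \<open>\<psi>\<close> replaces integrating \<open>deriv g\<close>, which need not be continuous.\<close>
    define \<epsilon> where "\<epsilon> i = sgn (fdiff s g (t (Suc i)) - fdiff s g (t i))" for i
    define \<psi> where "\<psi> u = (\<Sum>i<N. \<epsilon> i * (g (t (Suc i) + u) - g (t i + u)))" for u
    define \<psi>' where "\<psi>' u = (\<Sum>i<N. \<epsilon> i * (deriv g (t (Suc i) + u) - deriv g (t i + u)))" for u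
    have Dg: "((\<lambda>u. g (c + u)) has_real_derivative deriv g (c + u)) (at u)" for c u
      using DERIV_shift[of g "deriv g (c + u)" u c] D[of "c + u"] by (simp add: add.commute)
    have D\<psi>: "(\<psi> has_real_derivative \<psi>' u) (at u)" for u
      unfolding \<psi>_def[abs_def] \<psi>'_def by (intro DERIV_sum DERIV_cmult DERIV_diff Dg)
    \<comment> \<open>One intermediate point serves all summands at once, so the shifted points
      \<open>t i + z\<close> again form a chain, to which the variation bound for
      \<open>deriv g\<close> applies.\<close>
    obtain z where z: "\<psi> s - \<psi> 0 = (s - 0) * \<psi>' z"
      using MVT2[of 0 s \<psi> \<psi>'] D\<psi> \<open>s > 0\<close> by blast
    have "\<psi>' z \<le> (\<Sum>i<N. \<bar>deriv g (t (Suc i) + z) - deriv g (t i + z)\<bar>)"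
      unfolding \<psi>'_def
    proof (rule sum_mono)
      fix i
      have "\<epsilon> i * a \<le> \<bar>a\<bar>" for a
        unfolding \<epsilon>_def by (auto simp: sgn_if)
      thus "\<epsilon> i * (deriv g (t (Suc i) + z) - deriv g (t i + z)) \<le> \<bar>deriv g (t (Suc i) + z) - deriv g (t i + z)\<bar>" .
    qed
    also have "\<dots> \<le> V"
    proof -
      have "strict_mono_on {..N} (\<lambda>i. t i + z)"
        using t by (auto simp: strict_mono_on_def)
      from tv[unfolded total_variation_le_iff[OF \<open>V \<ge> 0\<close>], rule_format, OF this]
      show ?thesis .
    qed
    finally have "\<psi> s - \<psi> 0 \<le> s * V"
      using z \<open>s > 0\<close> by simp
    \<comment> \<open>Each sign is that of the increment it multiplies, so the products are absolute
      values.\<close>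
    moreover have "\<psi> s - \<psi> 0 = (\<Sum>i<N. \<bar>fdiff s g (t (Suc i)) - fdiff s g (t i)\<bar>)"
      unfolding \<psi>_def \<epsilon>_def sum_subtractf[symmetric]
      by (intro sum.cong refl) (simp add: linordered_idom_class.abs_sgn fdiff_def algebra_simps)
    ultimately show ?thesis by simp
  qed
  thus ?thesis using \<open>V \<ge> 0\<close> \<open>s > 0\<close> by (simp add: total_variation_le_iff)
qed

text \<open>Translation commutes with differentiation. This identifies the derivative of an iterated
  difference in the induction on the order.\<close>

lemma has_derivative_iterated_fdiff:
  assumes "\<And>x. (g has_real_derivative g' x) (at x)"
  shows "((fdiff s ^^ m) g has_real_derivative (fdiff s ^^ m) g' x) (at x)"
proof (induction m arbitrary: x)
  case (Suc m)
  have "((\<lambda>x. (fdiff s ^^ m) g (x + s)) has_real_derivative (fdiff s ^^ m) g' (x + s)) (at x)"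
    using Suc[of "x + s"] by (simp add: DERIV_shift)
  from DERIV_diff[OF this Suc] show ?case by (simp add: fdiff_def[of s "(fdiff s ^^ m) _"])
qed (use assms in simp)

text \<open>Peels off the first derivative instead of the last, as an induction that passes from
  \<open>g\<close> to \<open>deriv g\<close> requires.\<close>

lemma times_differentiable_Suc:
  "times_differentiable (Suc m) g \<longleftrightarrow> (\<forall>x. g differentiable (at x)) \<and> times_differentiable m (deriv g)"
proof -
  have "times_differentiable (Suc m) g \<longleftrightarrow>
      (\<forall>x. g differentiable (at x)) \<and> (\<forall>k<m. \<forall>x. (deriv ^^ Suc k) g differentiable (at x))"
    unfolding times_differentiable_def
    by (subst All_less_Suc2) simp
  thus ?thesis by (simp add: times_differentiable_def funpow_Suc_right del: funpow.simps)
qed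

text \<open>The induction hypothesis is applied to \<open>deriv g\<close>. Since its iterated
  difference is the derivative of that of \<open>g\<close>, one more difference costs one more
  factor \<open>s\<close>.\<close>

lemma total_variation_iterated_fdiff_le:
  assumes "times_differentiable m g" and "total_variation ((deriv ^^ m) g) \<le> ennreal V"
    and "V \<ge> 0" and "s > 0"
  shows "total_variation ((fdiff s ^^ m) g) \<le> ennreal (s ^ m * V)"
  using assms(1,2)
proof (induction m arbitrary: g)
  case (Suc m)
  have D: "(g has_real_derivative deriv g x) (at x)" for x
    using Suc.prems(1) by (simp add: DERIV_deriv_iff_real_differentiable times_differentiable_Suc)
  have *: "deriv ((fdiff s ^^ m) g) = (fdiff s ^^ m) (deriv g)"
    using has_derivative_iterated_fdiff[OF D] by (auto intro!: DERIV_imp_deriv)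
  have "total_variation ((fdiff s ^^ m) (deriv g)) \<le> ennreal (s ^ m * V)"
    using Suc.prems by (intro Suc.IH) (simp_all add: times_differentiable_Suc funpow_swap1)
  hence "total_variation (fdiff s ((fdiff s ^^ m) g)) \<le> ennreal (s * (s ^ m * V))"
    using assms(3,4) has_derivative_iterated_fdiff[OF D]
    by (intro total_variation_fdiff_le) (auto simp: * real_differentiable_def)
  thus ?case by (simp add: mult.assoc)
qed simp

text \<open>Cut the line into tiles of length \<open>s\<close> and fold them onto
  \<open>{0..<s}\<close>. At each point the folded integrand is a sum of increments of
  \<open>g\<close> along an arithmetic progression, hence at most \<open>V\<close>; integrating over
  one tile gives the factor \<open>s\<close>.\<close>

lemma nn_integral_fdiff_le:
  fixes g :: "real \<Rightarrow> real"
  assumes [measurable]: "g \<in> borel_measurable borel"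
    and tv: "total_variation g \<le> ennreal V" and "V \<ge> 0" and "s > 0"
  shows "(\<integral>\<^sup>+x. ennreal \<bar>fdiff s g x\<bar> \<partial>lborel) \<le> ennreal (s * V)"
proof -
  define F where "F = (\<lambda>x. ennreal \<bar>fdiff s g x\<bar>)"
  have F[measurable]: "F \<in> borel_measurable borel" unfolding F_def fdiff_def by measurable
  \<comment> \<open>Induction on the number of tiles; the new tile is translated back to
    \<open>{0..<s}\<close>.\<close>
  have piece: "(\<integral>\<^sup>+x. F x * indicator {a..<a + real N * s} x \<partial>lborel) =
      (\<integral>\<^sup>+x. (\<Sum>i<N. F (x + (a + real i * s))) * indicator {0..<s} x \<partial>lborel)" for a N
  proof (induction N)
    case (Suc N)
    have ind: "indicator {a..<a + real (Suc N) * s} x =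
        (indicator {a..<a + real N * s} x + indicator {a + real N * s..<a + real (Suc N) * s} x :: ennreal)" for x
      using \<open>s > 0\<close> by (auto simp: indicator_def algebra_simps) (smt (verit) mult_nonneg_nonneg of_nat_0_le_iff)
    have "(\<integral>\<^sup>+x. F x * indicator {a + real N * s..<a + real (Suc N) * s} x \<partial>lborel) =
       (\<integral>\<^sup>+x. F (a + real N * s + 1 * x) * indicator {a + real N * s..<a + real (Suc N) * s} (a + real N * s + 1 * x) \<partial>lborel)"
      by (subst nn_integral_real_affine[where c=1 and t="a + real N * s"]) auto
    also have "\<dots> = (\<integral>\<^sup>+x. F (x + (a + real N * s)) * indicator {0..<s} x \<partial>lborel)"
      by (intro nn_integral_cong) (auto simp: indicator_def algebra_simps)
    finally have st: "(\<integral>\<^sup>+x. F x * indicator {a + real N * s..<a + real (Suc N) * s} x \<partial>lborel) =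
      (\<integral>\<^sup>+x. F (x + (a + real N * s)) * indicator {0..<s} x \<partial>lborel)" .
    show ?case
      by (simp only: ind distrib_left distrib_right sum.lessThan_Suc)
        (subst nn_integral_add; (subst nn_integral_add)?; simp add: Suc st del: of_nat_Suc)
  qed simp
  have bound: "(\<integral>\<^sup>+x. F x * indicator {a..<a + real N * s} x \<partial>lborel) \<le> ennreal (s * V)" for a N
  proof -
    have "(\<Sum>i<N. F (x + (a + real i * s))) \<le> ennreal V" for x
    proof -
      have "strict_mono_on {..N} (\<lambda>i. x + (a + real i * s))"
        using \<open>s > 0\<close> by (auto simp: strict_mono_on_def)
      hence "(\<Sum>i<N. \<bar>g (x + (a + real (Suc i) * s)) - g (x + (a + real i * s))\<bar>) \<le> V"
        using tv \<open>V \<ge> 0\<close> unfolding total_variation_le_iff[OF \<open>V \<ge> 0\<close>] by blast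
      thus ?thesis using \<open>V \<ge> 0\<close>
        by (simp add: F_def fdiff_def sum_ennreal algebra_simps)
    qed
    hence "(\<integral>\<^sup>+x. (\<Sum>i<N. F (x + (a + real i * s))) * indicator {0..<s} x \<partial>lborel) \<le>
        (\<integral>\<^sup>+x. ennreal V * indicator {0..<s} x \<partial>lborel)"
      by (intro nn_integral_mono mult_right_mono) auto
    also have "\<dots> = ennreal (s * V)"
      using \<open>s > 0\<close> \<open>V \<ge> 0\<close> by (simp add: nn_integral_cmult_indicator ennreal_mult' mult.commute)
    finally show ?thesis by (simp add: piece)
  qed
  \<comment> \<open>This is the interval from \<open>- k * s\<close> to \<open>k * s\<close>,
    written as a starting point plus \<open>2 * k\<close> tiles to match
    \<open>bound\<close>.\<close>
  define A where "A k = {- (real k * s)..<- (real k * s) + real (2 * k) * s}" for k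
  have "A i \<subseteq> A j" if "i \<le> j" for i j
  proof -
    have "real i * s \<le> real j * s" using that \<open>s > 0\<close> by simp
    thus ?thesis unfolding A_def by (auto simp: algebra_simps)
  qed
  hence inc: "incseq (\<lambda>k x. F x * indicator (A k) x)"
    by (intro monoI le_funI mult_left_mono) (auto simp: indicator_def F_def dest: subsetD)
  have inA: "\<exists>k. x \<in> A k" for x
  proof -
    obtain k where "\<bar>x\<bar> / s < real k" using reals_Archimedean2 by blast
    hence "\<bar>x\<bar> < real k * s" using \<open>s > 0\<close> by (simp add: field_simps)
    thus ?thesis by (intro exI[of _ k]) (auto simp: A_def abs_less_iff mult.assoc mult.commute)
  qed
  have "(SUP k. F x * indicator (A k) x) = F x" for x
  proof -
    obtain k where "x \<in> A k" using inA by blast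
    hence "F x \<le> (SUP k. F x * indicator (A k) x)"
      by (intro SUP_upper2[of k]) auto
    moreover have "(SUP k. F x * indicator (A k) x) \<le> F x"
      by (intro SUP_least) (auto simp: indicator_def)
    ultimately show ?thesis by simp
  qed
  hence "(\<integral>\<^sup>+x. F x \<partial>lborel) = (\<integral>\<^sup>+x. (SUP k. F x * indicator (A k) x) \<partial>lborel)" by simp
  also have "\<dots> = (SUP k. \<integral>\<^sup>+x. F x * indicator (A k) x \<partial>lborel)"
    using inc by (intro nn_integral_monotone_convergence_SUP) (auto simp: A_def)
  also have "\<dots> \<le> ennreal (s * V)"
    unfolding A_def by (intro SUP_least bound)
  finally show ?thesis by (simp add: F_def)
qed

subsection \<open>Decay of the Fourier transform\<close>

lemma norm_integral_le:
  assumes "integrable M f" and "(\<integral>\<^sup>+x. ennreal (norm (f x)) \<partial>M) \<le> ennreal C" and "C \<ge> 0"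
  shows "norm (integral\<^sup>L M f) \<le> C"
  using order_trans[OF integral_norm_bound_ennreal[OF assms(1)] assms(2)] \<open>C \<ge> 0\<close> by simp

text \<open>Sign and normalisation are those of characteristic functions, so for a density this is
  \<open>char\<close>.\<close>

definition fourier :: "(real \<Rightarrow> real) \<Rightarrow> real \<Rightarrow> complex" where
  "fourier g t = (CLINT x|lborel. iexp (t * x) * complex_of_real (g x))"

lemma integrable_fourier:
  assumes "integrable lborel g"
  shows "integrable lborel (\<lambda>x. iexp (t * x) * complex_of_real (g x))"
  by (rule Bochner_Integration.integrable_bound[OF assms])
     (use borel_measurable_integrable[OF assms] in \<open>auto simp: norm_mult\<close>)

lemma norm_fourier_le:
  assumes [measurable]: "g \<in> borel_measurable borel"
    and "(\<integral>\<^sup>+x. ennreal \<bar>g x\<bar> \<partial>lborel) \<le> ennreal C" and "C \<ge> 0"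
  shows "cmod (fourier g t) \<le> C"
proof -
  have "integrable lborel g"
    using assms(2) by (intro integrableI_bounded) (auto intro: le_less_trans)
  thus ?thesis
    unfolding fourier_def using assms(2,3)
    by (intro norm_integral_le integrable_fourier) (simp_all add: norm_mult)
qed

lemma integrable_fdiff:
  assumes "integrable lborel g"
  shows "integrable lborel (fdiff s g)"
  unfolding fdiff_def using lborel_integrable_real_affine[OF assms, of 1 s] assms
  by (auto simp: add.commute)

lemma fourier_fdiff:
  assumes "integrable lborel g"
  shows "fourier (fdiff s g) t = (iexp (- (t * s)) - 1) * fourier g t"
proof -
  have int: "integrable lborel (\<lambda>x. g (x + s))"
    using lborel_integrable_real_affine[OF assms, of 1 s] by (simp add: add.commute)
  have "fourier g t = (CLINT x|lborel. iexp (t * (s + x)) * complex_of_real (g (s + x)))"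
    unfolding fourier_def
    by (subst lborel_integral_real_affine[where c=1 and t=s]) auto
  also have "\<dots> = (CLINT x|lborel. iexp (t * s) * (iexp (t * x) * complex_of_real (g (x + s))))"
    by (simp add: exp_add[symmetric] algebra_simps)
  also have "\<dots> = iexp (t * s) * fourier (\<lambda>x. g (x + s)) t"
    unfolding fourier_def by (subst integral_mult_right_zero) simp
  finally have "fourier (\<lambda>x. g (x + s)) t = iexp (- (t * s)) * fourier g t"
    by (simp add: exp_minus field_simps)
  moreover have "fourier (fdiff s g) t = fourier (\<lambda>x. g (x + s)) t - fourier g t"
    unfolding fourier_def fdiff_def
    using integrable_fourier[OF int, of t] integrable_fourier[OF assms, of t]
    by (simp add: right_diff_distrib)
  ultimately show ?thesis by (simp add: algebra_simps)
qed

lemma fourier_iterated_fdiff: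
  assumes "integrable lborel g"
  shows "integrable lborel ((fdiff s ^^ k) g) \<and>
    fourier ((fdiff s ^^ k) g) t = (iexp (- (t * s)) - 1) ^ k * fourier g t"
  using assms by (induction k) (auto intro!: integrable_fdiff simp: fourier_fdiff)

text \<open>A complex derivative at zero, restricted to real increments. It serves both the decay
  estimate and the inversion formula.\<close>

lemma tendsto_iexp_quotient: "((\<lambda>s. (iexp (- (t * s)) - 1) / s) \<longlongrightarrow> - (\<i> * t)) (at 0)"
proof -
  have "((\<lambda>z::complex. exp (- (\<i> * t * z))) has_field_derivative - (\<i> * t)) (at 0)"
    by (auto intro!: derivative_eq_intros)
  hence "((\<lambda>z::complex. (exp (- (\<i> * t * z)) - 1) / z) \<longlongrightarrow> - (\<i> * t)) (at 0)"
    by (simp add: DERIV_def)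
  moreover have "filterlim complex_of_real (at 0) (at 0)"
    by (auto simp: filterlim_at eventually_at_filter intro!: tendsto_eq_intros)
  ultimately have "((\<lambda>s. (exp (- (\<i> * t * complex_of_real s)) - 1) / s) \<longlongrightarrow> - (\<i> * t)) (at 0)"
    by (rule filterlim_compose)
  thus ?thesis by (simp add: mult.assoc)
qed

lemma tendsto_norm_iexp_quotient:
  "((\<lambda>s. cmod (iexp (- (t * s)) - 1) / s) \<longlongrightarrow> \<bar>t\<bar>) (at_right 0)"
proof -
  have "((\<lambda>s. cmod ((iexp (- (t * s)) - 1) / s)) \<longlongrightarrow> cmod (- (\<i> * t))) (at_right 0)"
    by (intro tendsto_norm tendsto_mono[OF _ tendsto_iexp_quotient]) (simp add: at_le)
  hence "((\<lambda>s. cmod ((iexp (- (t * s)) - 1) / s)) \<longlongrightarrow> \<bar>t\<bar>) (at_right 0)"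
    by (simp add: norm_mult)
  thus ?thesis
  proof (rule Lim_transform_eventually)
    show "\<forall>\<^sub>F s in at_right 0. cmod ((iexp (- (t * s)) - 1) / s) = cmod (iexp (- (t * s)) - 1) / s"
      using eventually_at_right_less[of "0::real"] by eventually_elim (simp add: norm_divide)
  qed
qed

text \<open>The first \<open>m\<close> differences use up the derivatives, and the last one turns
  variation into an integral bound. Dividing by \<open>s ^ Suc m\<close> and letting
  \<open>s\<close> tend to zero turns each factor \<open>cmod (iexp (- (t * s)) - 1) / s\<close>
  into \<open>\<bar>t\<bar>\<close>. The product form covers \<open>t = 0\<close> as well.\<close>

lemma norm_fourier_decay:
  assumes int: "integrable lborel g" and diff: "times_differentiable m g"
    and tv: "total_variation ((deriv ^^ m) g) \<le> ennreal V" and "V \<ge> 0"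
  shows "\<bar>t\<bar> ^ Suc m * cmod (fourier g t) \<le> V"
proof -
  have bound: "(cmod (iexp (- (t * s)) - 1) / s) ^ Suc m * cmod (fourier g t) \<le> V" if "s > 0" for s
  proof -
    define G where "G = (fdiff s ^^ m) g"
    have G: "integrable lborel G" "total_variation G \<le> ennreal (s ^ m * V)"
      using fourier_iterated_fdiff[OF int] total_variation_iterated_fdiff_le[OF diff tv] \<open>V \<ge> 0\<close> that
      by (auto simp: G_def)
    have [measurable]: "G \<in> borel_measurable borel" "fdiff s G \<in> borel_measurable borel"
      using borel_measurable_integrable[OF G(1)] borel_measurable_integrable[OF integrable_fdiff[OF G(1)]]
      by simp_all
    have "cmod (fourier (fdiff s G) t) \<le> s * (s ^ m * V)"
      using G that \<open>V \<ge> 0\<close> by (intro norm_fourier_le nn_integral_fdiff_le) auto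
    also have "fourier (fdiff s G) t = (iexp (- (t * s)) - 1) ^ Suc m * fourier g t"
      using fourier_iterated_fdiff[OF int, where k = "Suc m"] by (simp add: G_def)
    finally have "cmod (iexp (- (t * s)) - 1) ^ Suc m * cmod (fourier g t) \<le> V * s ^ Suc m"
      by (simp only: norm_mult norm_power power_Suc mult_ac)
    thus ?thesis using that
      by (simp only: power_divide times_divide_eq_left pos_divide_le_eq zero_less_power)
  qed
  have "((\<lambda>s. (cmod (iexp (- (t * s)) - 1) / s) ^ Suc m * cmod (fourier g t)) \<longlongrightarrow>
      \<bar>t\<bar> ^ Suc m * cmod (fourier g t)) (at_right 0)"
    by (intro tendsto_intros tendsto_norm_iexp_quotient)
  moreover have "\<forall>\<^sub>F s in at_right 0. (cmod (iexp (- (t * s)) - 1) / s) ^ Suc m * cmod (fourier g t) \<le> V"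
    using eventually_at_right_less[of "0::real"] by eventually_elim (rule bound)
  ultimately show ?thesis
    by (intro tendsto_upperbound[of _ _ "at_right (0::real)"]) auto
qed

subsection \<open>Fourier inversion for densities\<close>

lemma norm_iexp_quotient_le:
  assumes "a \<le> b" and "t \<noteq> 0"
  shows "cmod ((iexp (- (t * a)) - iexp (- (t * b))) / (\<i> * t)) \<le> b - a"
  using Levy_Inversion_aux2[of "- b" "- a" t] assms by simp

text \<open>Levy's inversion theorem gives a limit of integrals over growing symmetric windows. When
  \<open>char M\<close> is integrable, dominated convergence replaces this limit by an integral over
  the whole line.\<close>

lemma (in real_distribution) measure_Ioc_eq_char_integral:
  assumes int: "integrable lborel (char M)" and "a \<le> b" and "measure M {a} = 0" "measure M {b} = 0"
  shows "complex_of_real (measure M {a<..b}) =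
    1 / (2 * pi) * (CLBINT t. (iexp (- (t * a)) - iexp (- (t * b))) / (\<i> * t) * char M t)"
proof -
  define F where "F t = (iexp (- (t * a)) - iexp (- (t * b))) / (\<i> * t) * char M t" for t :: real
  have [measurable]: "F \<in> borel_measurable borel" unfolding F_def by measurable
  have bound: "cmod (F t) \<le> (b - a) * cmod (char M t)" for t
  \<comment> \<open>At zero the quotient has the value \<open>0\<close>, by the convention for
    division.\<close>
  proof (cases "t = 0")
    case False
    have "cmod ((iexp (- (t * a)) - iexp (- (t * b))) / (\<i> * t)) \<le> b - a"
      using \<open>a \<le> b\<close> False by (rule norm_iexp_quotient_le)
    thus ?thesis unfolding F_def norm_mult by (rule mult_right_mono) simp
  qed (use \<open>a \<le> b\<close> in \<open>simp add: F_def\<close>)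
  have "(\<lambda>n. CLBINT t. indicator {- real n<..<real n} t *\<^sub>R F t) \<longlonglongrightarrow> (CLBINT t. F t)"
  proof (rule integral_dominated_convergence[where w="\<lambda>t. (b - a) * cmod (char M t)"])
    show "integrable lborel (\<lambda>t. (b - a) * cmod (char M t))"
      using int by auto
    show "AE t in lborel. (\<lambda>n. indicator {- real n<..<real n} t *\<^sub>R F t) \<longlonglongrightarrow> F t"
    proof (intro AE_I2 tendsto_eventually)
      fix t :: real
      obtain N where "\<bar>t\<bar> < real N" using reals_Archimedean2 by blast
      thus "\<forall>\<^sub>F n in sequentially. indicator {- real n<..<real n} t *\<^sub>R F t = F t"
        by (intro eventually_sequentiallyI[of N]) (auto simp: indicator_def)
    qed
    show "AE t in lborel. cmod (indicator {- real n<..<real n} t *\<^sub>R F t) \<le> (b - a) * cmod (char M t)" for n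
      using bound order.trans[OF norm_ge_zero bound] by (auto simp: indicator_def)
  qed auto
  hence "(\<lambda>n. 1 / (2 * pi) * (CLBINT t. indicator {- real n<..<real n} t *\<^sub>R F t)) \<longlonglongrightarrow>
      1 / (2 * pi) * (CLBINT t. F t)"
    by (intro tendsto_intros)
  moreover have "(\<lambda>n. 1 / (2 * pi) * (CLBINT t. indicator {- real n<..<real n} t *\<^sub>R F t)) \<longlonglongrightarrow>
      complex_of_real (measure M {a<..b})"
    using Levy_Inversion[OF assms(2-4)]
    by (simp add: interval_lebesgue_integral_def set_lebesgue_integral_def F_def)
  ultimately show ?thesis using LIMSEQ_unique unfolding F_def by blast
qed

lemma char_density_eq_fourier:
  assumes [measurable]: "p \<in> borel_measurable borel" and "\<And>x. p x \<ge> 0"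
  shows "char (density lborel (\<lambda>x. ennreal (p x))) = fourier p"
  unfolding char_def fourier_def using assms(2)
  by (subst integral_density) (auto simp: scaleR_conv_of_real mult.commute)

text \<open>Divide the formula for the mass of a short interval to the right of \<open>x\<close> by
  its length \<open>d\<close> and let \<open>d\<close> tend to zero. Continuity of \<open>p\<close>
  gives the limit on the left by the fundamental theorem of calculus; on the right
  \<open>cmod (fourier p t)\<close> dominates.\<close>

lemma density_inversion:
  assumes cont: "continuous_on UNIV p" and nonneg: "\<And>x. p x \<ge> 0"
    and prob: "prob_space (density lborel (\<lambda>x. ennreal (p x)))"
    and int: "integrable lborel (fourier p)"
  shows "complex_of_real (p x) = 1 / (2 * pi) * (CLBINT t. iexp (- (t * x)) * fourier p t)"
proof -
  have p[measurable]: "p \<in> borel_measurable borel"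
    using cont by (rule borel_measurable_continuous_onI)
  define M where "M = density lborel (\<lambda>x. ennreal (p x))"
  interpret real_distribution M
    using prob by (auto simp: M_def real_distribution_def real_distribution_axioms_def)
  have char: "char M = fourier p" unfolding M_def using nonneg by (simp add: char_density_eq_fourier)
  \<comment> \<open>Levy's formula requires interval endpoints without mass.\<close>
  have atom: "measure M {a} = 0" for a
  proof -
    have "emeasure M {a} = 0" unfolding M_def
      by (subst emeasure_density) (auto simp: nn_integral_0_iff_AE intro!: AE_I[of _ _ "{a}"] split: split_indicator)
    thus ?thesis by (simp add: measure_def)
  qed
  \<comment> \<open>A sequence of lengths, as dominated convergence is sequential; lengths at most
    \<open>1\<close> keep \<open>x + e n\<close> inside \<open>{x..x + 1}\<close>.\<close>
  define e where "e n = 1 / real (Suc n)" for n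
  have e: "e n > 0" "e \<longlonglongrightarrow> 0" for n
    unfolding e_def using LIMSEQ_inverse_real_of_nat by (simp_all add: field_simps)
  have measure_eq: "measure M {x<..x + d} = integral {x..x + d} p" if "d \<ge> 0" for d
  proof -
    have "set_integrable lborel {x..x + d} p"
      unfolding set_integrable_def by (rule borel_integrable_compact) (auto intro: continuous_on_subset[OF cont])
    note I = set_borel_integral_eq_integral[OF this]
    have "(\<integral>\<^sup>+y. ennreal (p y) * indicator {x..x + d} y \<partial>lborel) =
        (\<integral>\<^sup>+y. ennreal (indicator {x..x + d} y *\<^sub>R p y) \<partial>lborel)"
      by (intro nn_integral_cong) (auto simp: indicator_def)
    also have "\<dots> = ennreal (integral {x..x + d} p)"
      using nonneg \<open>set_integrable lborel {x..x + d} p\<close> I(2)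
      unfolding set_integrable_def set_lebesgue_integral_def by (subst nn_integral_eq_integral) auto
    finally have nn: "(\<integral>\<^sup>+y. ennreal (p y) * indicator {x..x + d} y \<partial>lborel) = ennreal (integral {x..x + d} p)" .
    have "emeasure M {x<..x + d} = (\<integral>\<^sup>+y. ennreal (p y) * indicator {x<..x + d} y \<partial>lborel)"
      unfolding M_def by (subst emeasure_density) auto
    also have "\<dots> = (\<integral>\<^sup>+y. ennreal (p y) * indicator {x..x + d} y \<partial>lborel)"
      by (intro nn_integral_cong_AE AE_I[of _ _ "{x}"]) (auto split: split_indicator)
    finally have "emeasure M {x<..x + d} = ennreal (integral {x..x + d} p)" using nn by simp
    thus ?thesis using nonneg by (simp add: measure_def Henstock_Kurzweil_Integration.integral_nonneg I(1))
  qed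
  have "(\<lambda>n. measure M {x<..x + e n} / e n) \<longlonglongrightarrow> p x"
  proof -
    have "((\<lambda>u. integral {x..u} p) has_real_derivative p x) (at x within {x..x + 1})"
      by (rule integral_has_real_derivative) (auto intro: continuous_on_subset[OF cont])
    hence "((\<lambda>u. (integral {x..u} p - integral {x..x} p) / (u - x)) \<longlongrightarrow> p x) (at x within {x..x + 1})"
      by (simp add: has_field_derivative_iff)
    moreover have "filterlim (\<lambda>n. x + e n) (at x within {x..x + 1}) sequentially"
    proof -
      have "(\<lambda>n. x + e n) \<longlonglongrightarrow> x" using tendsto_add[OF tendsto_const e(2), of x] by simp
      moreover have "e n \<noteq> 0" "e n \<ge> 0" "e n \<le> 1" for n using e(1)[of n] by (auto simp: e_def)
      ultimately show ?thesis by (auto simp: filterlim_at)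
    qed
    ultimately have "(\<lambda>n. (integral {x..x + e n} p - integral {x..x} p) / (x + e n - x)) \<longlonglongrightarrow> p x"
      by (rule filterlim_compose)
    thus ?thesis using e by (simp add: measure_eq less_imp_le)
  qed
  hence 1: "(\<lambda>n. complex_of_real (measure M {x<..x + e n} / e n)) \<longlonglongrightarrow> complex_of_real (p x)"
    by (rule tendsto_of_real)
  define q where "q d t = (iexp (- (t * x)) - iexp (- (t * (x + d)))) / (\<i> * t)" for d t :: real
  have q_bound: "cmod (q d t) \<le> d" if "d > 0" for d t
  proof (cases "t = 0")
    case False
    thus ?thesis using norm_iexp_quotient_le[of x "x + d" t] that unfolding q_def by simp
  qed (use that in \<open>simp add: q_def\<close>)
  have q_lim: "(\<lambda>n. q (e n) t / e n) \<longlonglongrightarrow> iexp (- (t * x))" if "t \<noteq> 0" for t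
  proof -
    have "filterlim e (at 0) sequentially"
      using e by (auto simp: filterlim_at intro!: always_eventually less_imp_neq[symmetric])
    with tendsto_iexp_quotient have "(\<lambda>n. (iexp (- (t * e n)) - 1) / e n) \<longlonglongrightarrow> - (\<i> * t)"
      by (rule filterlim_compose)
    hence "(\<lambda>n. iexp (- (t * x)) / (- (\<i> * t)) * ((iexp (- (t * e n)) - 1) / e n))
        \<longlonglongrightarrow> iexp (- (t * x)) / (- (\<i> * t)) * (- (\<i> * t))"
      by (intro tendsto_intros)
    moreover have "iexp (- (t * x)) / (- (\<i> * t)) * ((iexp (- (t * e n)) - 1) / e n)
        = q (e n) t / e n" for n
    proof -
      have "iexp (- (t * (x + e n))) = iexp (- (t * x)) * iexp (- (t * e n))"
        by (simp add: exp_add[symmetric] algebra_simps)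
      thus ?thesis using that e(1)[of n] unfolding q_def by (simp add: field_simps)
    qed
    ultimately show ?thesis using that by simp
  qed
  have "(\<lambda>n. CLBINT t. q (e n) t / e n * fourier p t) \<longlonglongrightarrow> (CLBINT t. iexp (- (t * x)) * fourier p t)"
  proof (rule integral_dominated_convergence[where w="\<lambda>t. cmod (fourier p t)"])
    show "AE t in lborel. (\<lambda>n. q (e n) t / e n * fourier p t) \<longlonglongrightarrow> iexp (- (t * x)) * fourier p t"
    \<comment> \<open>At \<open>t = 0\<close> division by zero makes \<open>q\<close> vanish,
      whereas \<open>iexp (- (t * x))\<close> is \<open>1\<close>; this null set is left
      out.\<close>
    proof (intro AE_I[of _ _ "{0}"] subsetI)
      fix t assume "t \<in> {t \<in> space lborel. \<not> (\<lambda>n. q (e n) t / e n * fourier p t) \<longlonglongrightarrow> iexp (- (t * x)) * fourier p t}"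
      thus "t \<in> {0}" using tendsto_mult[OF q_lim tendsto_const, of t "fourier p t"] by blast
    qed auto
    show "AE t in lborel. cmod (q (e n) t / e n * fourier p t) \<le> cmod (fourier p t)" for n
    proof (intro AE_I2)
      fix t :: real
      have "cmod (q (e n) t / e n) \<le> 1"
        using q_bound[OF e(1)[of n], of t] e(1)[of n] by (simp add: norm_divide)
      thus "cmod (q (e n) t / e n * fourier p t) \<le> cmod (fourier p t)"
        unfolding norm_mult by (intro mult_left_le_one_le) auto
    qed
    show "integrable lborel (\<lambda>t. cmod (fourier p t))" using int by auto
    show "(\<lambda>t. iexp (- (t * x)) * fourier p t) \<in> borel_measurable lborel"
      using char_measurable by (simp add: char)
    show "(\<lambda>t. q (e n) t / e n * fourier p t) \<in> borel_measurable lborel" for n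
      using char_measurable unfolding q_def by (simp add: char)
  qed
  hence "(\<lambda>n. 1 / (2 * pi) * (CLBINT t. q (e n) t / e n * fourier p t)) \<longlonglongrightarrow>
      1 / (2 * pi) * (CLBINT t. iexp (- (t * x)) * fourier p t)"
    by (intro tendsto_intros)
  moreover have "complex_of_real (measure M {x<..x + e n} / e n) =
      1 / (2 * pi) * (CLBINT t. q (e n) t / e n * fourier p t)" for n
  proof -
    have "complex_of_real (measure M {x<..x + e n}) = 1 / (2 * pi) * (CLBINT t. q (e n) t * fourier p t)"
      using measure_Ioc_eq_char_integral[of x "x + e n"] int e(1)[of n] atom by (simp add: char q_def)
    moreover have "(CLBINT t. q (e n) t / e n * fourier p t) = (CLBINT t. q (e n) t * fourier p t) / e n"
      by (subst integral_divide_zero[symmetric]) simp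
    ultimately show ?thesis by simp
  qed
  ultimately show ?thesis using 1 LIMSEQ_unique by auto
qed

subsection \<open>Integrals of functions with power decay\<close>

text \<open>On the right half-line \<open>- 1 / (m * t ^ m)\<close> is a primitive vanishing at
  infinity; the left half follows by reflection.\<close>

lemma nn_integral_inverse_power_tail:
  fixes a :: real
  assumes "a > 0" and "m \<ge> 1"
  shows "(\<integral>\<^sup>+t. ennreal (1 / \<bar>t\<bar> ^ Suc m) * indicator {t. a \<le> \<bar>t\<bar>} t \<partial>lborel) = ennreal (2 / (m * a ^ m))"
proof -
  have right: "(\<integral>\<^sup>+t. ennreal (1 / \<bar>t\<bar> ^ Suc m) * indicator {a..} t \<partial>lborel) = ennreal (1 / (m * a ^ m))"
  proof -
    have "((\<lambda>t. - 1 / (m * t ^ m)) has_real_derivative 1 / \<bar>t\<bar> ^ Suc m) (at t)" if "a \<le> t" for t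
    proof -
      have "t > 0" using that \<open>a > 0\<close> by simp
      obtain k where m: "m = Suc k" using \<open>m \<ge> 1\<close> by (cases m) auto
      have "((\<lambda>t. t ^ m) has_real_derivative m * t ^ k) (at t)"
        using DERIV_pow[of m t] by (simp add: m)
      from DERIV_divide[OF DERIV_const[of "- 1"] DERIV_cmult[OF this, of m]]
      have "((\<lambda>t. - 1 / (m * t ^ m)) has_real_derivative (m * (m * t ^ k)) / (m * t ^ m)\<^sup>2) (at t)"
        using \<open>t > 0\<close> \<open>m \<ge> 1\<close> by (simp add: power2_eq_square)
      also have "(m * (m * t ^ k)) / (m * t ^ m)\<^sup>2 = 1 / \<bar>t\<bar> ^ Suc m"
      proof -
        have "(r * (r * u)) / (r * (t * u))\<^sup>2 = 1 / (t * (t * u))" if "r > 0" "u > 0" for r u :: real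
          using that \<open>t > 0\<close> by (simp add: power2_eq_square field_simps)
        from this[of m "t ^ k"] show ?thesis using \<open>t > 0\<close> by (simp add: m)
      qed
      finally show ?thesis .
    qed
    moreover have "((\<lambda>t::real. - 1 / (m * t ^ m)) \<longlongrightarrow> 0) at_top"
      using \<open>m \<ge> 1\<close> by (intro tendsto_divide_0[OF tendsto_const] filterlim_at_top_imp_at_infinity
        filterlim_tendsto_pos_mult_at_top[OF tendsto_const] filterlim_pow_at_top filterlim_ident) auto
    ultimately have "(\<integral>\<^sup>+t. ennreal (1 / \<bar>t\<bar> ^ Suc m) * indicator {a..} t \<partial>lborel) = ennreal (0 - - 1 / (m * a ^ m))"
      by (intro nn_integral_FTC_atLeast) auto
    thus ?thesis by simp
  qed
  have left: "(\<integral>\<^sup>+t. ennreal (1 / \<bar>t\<bar> ^ Suc m) * indicator {..- a} t \<partial>lborel) = ennreal (1 / (m * a ^ m))"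
    using right by (subst nn_integral_real_affine[where c="- 1" and t=0])
      (auto simp: indicator_def le_minus_iff cong: if_cong)
  have "(\<integral>\<^sup>+t. ennreal (1 / \<bar>t\<bar> ^ Suc m) * indicator {t. a \<le> \<bar>t\<bar>} t \<partial>lborel) =
      (\<integral>\<^sup>+t. ennreal (1 / \<bar>t\<bar> ^ Suc m) * indicator {a..} t + ennreal (1 / \<bar>t\<bar> ^ Suc m) * indicator {..- a} t \<partial>lborel)"
    using \<open>a > 0\<close> by (intro nn_integral_cong) (auto simp: indicator_def abs_if)
  also have "\<dots> = ennreal (1 / (m * a ^ m)) + ennreal (1 / (m * a ^ m))"
    by (subst nn_integral_add) (auto simp: left right simp del: power_Suc)
  also have "\<dots> = ennreal (2 / (m * a ^ m))"
    using \<open>a > 0\<close> by (subst ennreal_plus[symmetric]) auto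
  finally show ?thesis .
qed

lemma nn_integral_decay_tail:
  fixes F :: "real \<Rightarrow> 'b :: real_normed_vector"
  assumes "V \<ge> 0" and "\<And>t. \<bar>t\<bar> ^ Suc m * norm (F t) \<le> V" and "a > 0" and "m \<ge> 1"
  shows "(\<integral>\<^sup>+t. ennreal (norm (F t)) * indicator {t. a \<le> \<bar>t\<bar>} t \<partial>lborel) \<le> ennreal (2 * V / (m * a ^ m))"
proof -
  have "(\<integral>\<^sup>+t. ennreal (norm (F t)) * indicator {t. a \<le> \<bar>t\<bar>} t \<partial>lborel) \<le>
      (\<integral>\<^sup>+t. ennreal V * (ennreal (1 / \<bar>t\<bar> ^ Suc m) * indicator {t. a \<le> \<bar>t\<bar>} t) \<partial>lborel)"
  proof (intro nn_integral_mono)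
    fix t :: real
    show "ennreal (norm (F t)) * indicator {t. a \<le> \<bar>t\<bar>} t \<le> ennreal V * (ennreal (1 / \<bar>t\<bar> ^ Suc m) * indicator {t. a \<le> \<bar>t\<bar>} t)"
    proof (cases "a \<le> \<bar>t\<bar>")
      case True
      hence "\<bar>t\<bar> ^ Suc m > 0" using \<open>a > 0\<close> by auto
      hence "norm (F t) \<le> V * (1 / \<bar>t\<bar> ^ Suc m)"
        using assms(2)[of t] by (simp add: field_simps)
      thus ?thesis using True \<open>V \<ge> 0\<close> by (simp add: ennreal_mult[symmetric] ennreal_leI)
    qed simp
  qed
  also have "\<dots> = ennreal V * ennreal (2 / (m * a ^ m))"
    by (subst nn_integral_cmult) (use nn_integral_inverse_power_tail[OF assms(3,4)] in auto)
  also have "\<dots> = ennreal (2 * V / (m * a ^ m))"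
    using \<open>V \<ge> 0\<close> \<open>a > 0\<close> by (simp add: ennreal_mult[symmetric] mult.commute)
  finally show ?thesis .
qed

text \<open>Split at \<open>\<bar>t\<bar> = a\<close>, with the constant bound inside and the decay
  outside. The cut is \<open>T\<close> for the Fourier transform and \<open>1\<close> for the
  squared kernel.\<close>

lemma nn_integral_decay_le:
  fixes F :: "real \<Rightarrow> 'b :: {real_normed_vector, second_countable_topology}"
  assumes [measurable]: "F \<in> borel_measurable borel"
    and "C \<ge> 0" and "\<And>t. norm (F t) \<le> C"
    and "V \<ge> 0" and "\<And>t. \<bar>t\<bar> ^ Suc m * norm (F t) \<le> V" and "a > 0" and "m \<ge> 1"
  shows "(\<integral>\<^sup>+t. ennreal (norm (F t)) \<partial>lborel) \<le> ennreal (2 * a * C + 2 * V / (m * a ^ m))"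
proof -
  have "(\<integral>\<^sup>+t. ennreal (norm (F t)) \<partial>lborel) =
      (\<integral>\<^sup>+t. ennreal (norm (F t)) * indicator {-a<..<a} t + ennreal (norm (F t)) * indicator {t. a \<le> \<bar>t\<bar>} t \<partial>lborel)"
    using \<open>a > 0\<close> by (intro nn_integral_cong) (auto simp: indicator_def abs_if)
  also have "\<dots> = (\<integral>\<^sup>+t. ennreal (norm (F t)) * indicator {-a<..<a} t \<partial>lborel) +
      (\<integral>\<^sup>+t. ennreal (norm (F t)) * indicator {t. a \<le> \<bar>t\<bar>} t \<partial>lborel)"
    by (rule nn_integral_add) auto
  also have "\<dots> \<le> (\<integral>\<^sup>+t. ennreal C * indicator {-a<..<a} t \<partial>lborel) + ennreal (2 * V / (m * a ^ m))"
    using assms by (intro add_mono nn_integral_decay_tail nn_integral_mono mult_right_mono ennreal_leI) auto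
  also have "\<dots> = ennreal (2 * a * C + 2 * V / (m * a ^ m))"
    using assms by (simp add: nn_integral_cmult_indicator ennreal_mult[symmetric] ennreal_plus[symmetric] mult_ac
      del: ennreal_plus)
  finally show ?thesis .
qed

subsection \<open>The sinc kernel\<close>

lemma sinc_kernel_measurable [measurable]: "sinc_kernel \<in> borel_measurable borel"
  unfolding sinc_kernel_def[abs_def] by measurable

lemma abs_sinc_kernel_le: "\<bar>sinc_kernel x\<bar> \<le> 1 / pi"
proof (cases "x = 0")
  case False
  have "\<bar>sin x\<bar> / \<bar>x\<bar> \<le> 1" using abs_sin_x_le_abs_x[of x] False by (simp add: field_simps)
  thus ?thesis using False by (simp add: sinc_kernel_def abs_mult divide_simps)
qed (simp add: sinc_kernel_def)

text \<open>
  The exact value is \<open>1 / \<pi>\<close>. The crude constant \<open>4 / \<pi>\<^sup>2\<close>, from \<open>K\<^sup>2 \<le> min 1 (1 / x\<^sup>2) / \<pi>\<^sup>2\<close>, is absorbed by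
  the slack in the variance term of the theorem.
\<close>
lemma nn_integral_sinc_kernel_power2_le:
  "(\<integral>\<^sup>+x. ennreal ((sinc_kernel x)\<^sup>2) \<partial>lborel) \<le> ennreal (4 / pi\<^sup>2)"
proof -
  have "\<bar>x\<bar> ^ Suc 1 * norm ((sinc_kernel x)\<^sup>2) \<le> 1 / pi\<^sup>2" for x
  proof (cases "x = 0")
    case False
    have "(sin x)\<^sup>2 \<le> 1" using abs_sin_le_one[of x] by (simp add: abs_square_le_1)
    thus ?thesis using False by (simp add: sinc_kernel_def power_divide power_mult_distrib divide_simps flip: power2_eq_square)
  qed simp
  moreover have "norm ((sinc_kernel x)\<^sup>2) \<le> 1 / pi\<^sup>2" for x
    using power_mono[OF abs_sinc_kernel_le[of x], of 2] by (simp add: power_divide)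
  ultimately show ?thesis
    using nn_integral_decay_le[of "\<lambda>x. (sinc_kernel x)\<^sup>2" "1 / pi\<^sup>2" "1 / pi\<^sup>2" 1 1] by simp
qed

text \<open>The rescaled kernel is the Fourier integral of the frequency window from
  \<open>- 1 / h\<close> to \<open>1 / h\<close>, which is what makes the bias a truncation error.
  The case \<open>x = y\<close> is separate because the primitive divides by
  \<open>y - x\<close>.\<close>

lemma sinc_kernel_eq_integral:
  assumes "h > 0"
  shows "complex_of_real (1 / h * sinc_kernel ((x - y) / h)) =
    1 / (2 * pi) * (CLBINT t. indicator {- 1 / h..1 / h} t *\<^sub>R iexp (t * (y - x)))"
proof (cases "x = y")
  case True
  thus ?thesis using assms by (simp add: sinc_kernel_def scaleR_conv_of_real)
next
  case False
  define c where "c = y - x"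
  have "c \<noteq> 0" using False by (simp add: c_def)
  have "(CLBINT t. indicator {- 1 / h..1 / h} t *\<^sub>R iexp (t * c)) =
      iexp (1 / h * c) / (\<i> * c) - iexp (- 1 / h * c) / (\<i> * c)"
  proof (rule integral_FTC_Icc)
    show "- 1 / h \<le> 1 / h" using assms by (simp add: field_simps)
    show "((\<lambda>t. iexp (t * c) / (\<i> * c)) has_vector_derivative iexp (t * c)) (at t within {- 1 / h..1 / h})" for t
    proof -
      have "((\<lambda>z. exp (\<i> * (z * complex_of_real c)) / (\<i> * c)) has_field_derivative iexp (t * c)) (at (complex_of_real t))"
        using \<open>c \<noteq> 0\<close> by (auto intro!: derivative_eq_intros simp: mult_ac)
      from has_vector_derivative_real_field[OF this] show ?thesis by simp
    qed
    show "continuous_on {- 1 / h..1 / h} (\<lambda>t. iexp (t * c))" by (intro continuous_intros)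
  qed
  also have "\<dots> = (iexp (c / h) - iexp (- (c / h))) / (\<i> * c)"
    by (simp add: diff_divide_distrib)
  also have "iexp (c / h) - iexp (- (c / h)) = 2 * \<i> * complex_of_real (sin (c / h))"
    by (simp add: complex_eq_iff Re_exp Im_exp)
  also have "2 * \<i> * complex_of_real (sin (c / h)) / (\<i> * c) = complex_of_real (2 * sin (c / h) / c)"
    by simp
  finally have "(CLBINT t. indicator {- 1 / h..1 / h} t *\<^sub>R iexp (t * c)) = complex_of_real (2 * sin (c / h) / c)" .
  moreover have "1 / h * sinc_kernel ((x - y) / h) = 1 / (2 * pi) * (2 * sin (c / h) / c)"
  proof -
    have *: "(x - y) / h = - (c / h)" by (simp add: c_def minus_divide_left)
    have "1 / h * (s / (pi * (c / h))) = 1 / (2 * pi) * (2 * s / c)" for s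
      using \<open>c \<noteq> 0\<close> assms by simp
    moreover have "sinc_kernel (- (c / h)) = sin (c / h) / (pi * (c / h))"
      using \<open>c \<noteq> 0\<close> assms by (simp add: sinc_kernel_def)
    ultimately show ?thesis unfolding * by simp
  qed
  ultimately show ?thesis by (simp add: c_def)
qed

text \<open>The mean of one summand of the estimator is a truncated inversion integral. Fubini
  applies because the integrand is bounded by \<open>1\<close> and lives on a set of finite product
  measure.\<close>

lemma (in real_distribution) integral_sinc_kernel:
  assumes "h > 0"
  shows "complex_of_real (\<integral>y. 1 / h * sinc_kernel ((x - y) / h) \<partial>M) =
    1 / (2 * pi) * (CLBINT t. indicator {- 1 / h..1 / h} t *\<^sub>R (iexp (- (t * x)) * char M t))"
proof -
  interpret P: pair_sigma_finite lborel M ..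
  have int: "complex_integrable (lborel \<Otimes>\<^sub>M M) (\<lambda>(t, y). indicator {- 1 / h..1 / h} t *\<^sub>R iexp (t * (y - x)))"
  proof (rule integrableI_bounded_set[where A="{- 1 / h..1 / h} \<times> space M" and B=1])
    show "emeasure (lborel \<Otimes>\<^sub>M M) ({- 1 / h..1 / h} \<times> space M) < \<infinity>"
      by (subst emeasure_pair_measure_Times) (use emeasure_space_1 in \<open>auto simp: emeasure_lborel_Icc_eq\<close>)
  qed (auto intro!: AE_I2 simp: indicator_def)
  have "complex_of_real (\<integral>y. 1 / h * sinc_kernel ((x - y) / h) \<partial>M) =
      (CLINT y|M. complex_of_real (1 / h * sinc_kernel ((x - y) / h)))"
    by (rule integral_complex_of_real[symmetric])
  also have "\<dots> = (CLINT y|M. 1 / (2 * pi) * (CLBINT t. indicator {- 1 / h..1 / h} t *\<^sub>R iexp (t * (y - x))))"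
    by (simp only: sinc_kernel_eq_integral[OF assms])
  also have "\<dots> = 1 / (2 * pi) * (CLINT y|M. (CLBINT t. indicator {- 1 / h..1 / h} t *\<^sub>R iexp (t * (y - x))))"
    by (rule integral_mult_right_zero)
  also have "(CLINT y|M. (CLBINT t. indicator {- 1 / h..1 / h} t *\<^sub>R iexp (t * (y - x)))) =
      (CLBINT t. (CLINT y|M. indicator {- 1 / h..1 / h} t *\<^sub>R iexp (t * (y - x))))"
    by (rule P.Fubini_integral[OF int])
  also have "\<dots> = (CLBINT t. indicator {- 1 / h..1 / h} t *\<^sub>R (iexp (- (t * x)) * char M t))"
  proof (rule Bochner_Integration.integral_cong)
    fix t :: real
    have "iexp (t * (y - x)) = iexp (- (t * x)) * iexp (t * y)" for y
      by (simp add: exp_add[symmetric] algebra_simps)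
    thus "(CLINT y|M. indicator {- 1 / h..1 / h} t *\<^sub>R iexp (t * (y - x))) =
        indicator {- 1 / h..1 / h} t *\<^sub>R (iexp (- (t * x)) * char M t)"
      unfolding char_def by simp
  qed simp
  finally show ?thesis .
qed

subsection \<open>Bias and variance\<close>

text \<open>Bias-variance decomposition: after centring, independence removes the mixed products,
  and each variance is at most the second moment.\<close>

lemma (in prob_space) mean_squared_error_le:
  fixes Z :: "'i \<Rightarrow> 'a \<Rightarrow> real"
  assumes I: "finite I" "I \<noteq> {}" and indep: "indep_vars (\<lambda>_. borel) Z I"
    and bdd: "\<And>i \<omega>. i \<in> I \<Longrightarrow> \<bar>Z i \<omega>\<bar> \<le> C"
    and mean: "\<And>i. i \<in> I \<Longrightarrow> expectation (Z i) = \<mu>"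
    and second: "\<And>i. i \<in> I \<Longrightarrow> expectation (\<lambda>\<omega>. (Z i \<omega>)\<^sup>2) \<le> B"
  shows "(\<integral>\<^sup>+\<omega>. ennreal ((1 / card I * (\<Sum>i\<in>I. Z i \<omega>) - \<theta>)\<^sup>2) \<partial>M) \<le> ennreal ((\<mu> - \<theta>)\<^sup>2 + B / card I)"
proof -
  define n where "n = real (card I)"
  have "n > 0" using I by (simp add: n_def card_gt_0_iff)
  define W where "W = (\<lambda>i \<omega>. Z i \<omega> - \<mu>)"
  have meas: "Z i \<in> borel_measurable M" if "i \<in> I" for i
    using indep that by (simp add: indep_vars_def)
  have intZ: "integrable M (Z i)" if "i \<in> I" for i
    by (rule integrable_const_bound[of _ C]) (use bdd that meas in auto)
  have intZ2: "integrable M (\<lambda>\<omega>. (Z i \<omega>)\<^sup>2)" if "i \<in> I" for i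
  proof (rule integrable_const_bound[of _ "C\<^sup>2"])
    have "(Z i \<omega>)\<^sup>2 \<le> C\<^sup>2" for \<omega> using bdd[OF that, of \<omega>] by (simp add: abs_le_square_iff power2_le_iff_abs_le)
    thus "AE \<omega> in M. norm ((Z i \<omega>)\<^sup>2) \<le> C\<^sup>2" by simp
  qed (use meas that in measurable)
  have intW: "integrable M (W i)" and expW: "expectation (W i) = 0" if "i \<in> I" for i
    unfolding W_def using intZ[OF that] mean[OF that] by (auto simp: prob_space)
  have W2: "expectation (\<lambda>\<omega>. W i \<omega> * W i \<omega>) \<le> B" if "i \<in> I" for i
  proof -
    have "expectation (\<lambda>\<omega>. W i \<omega> * W i \<omega>) = variance (Z i)"
      using mean[OF that] by (simp add: W_def power2_eq_square)
    also have "\<dots> \<le> expectation (\<lambda>\<omega>. (Z i \<omega>)\<^sup>2)"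
      using variance_eq[OF intZ[OF that] intZ2[OF that]] by simp
    also have "\<dots> \<le> B" by (rule second[OF that])
    finally show ?thesis .
  qed
  have intWW: "integrable M (\<lambda>\<omega>. W i \<omega> * W j \<omega>)" if "i \<in> I" "j \<in> I" for i j
  proof (rule Bochner_Integration.integrable_bound)
    show "integrable M (\<lambda>\<omega>. (W i \<omega>)\<^sup>2 + (W j \<omega>)\<^sup>2)"
      using intZ intZ2 that by (auto simp: W_def power2_diff)
    show "AE \<omega> in M. norm (W i \<omega> * W j \<omega>) \<le> norm ((W i \<omega>)\<^sup>2 + (W j \<omega>)\<^sup>2)"
    proof (intro AE_I2)
      fix \<omega>
      have "2 * \<bar>W i \<omega>\<bar> * \<bar>W j \<omega>\<bar> \<le> (W i \<omega>)\<^sup>2 + (W j \<omega>)\<^sup>2"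
        using sum_squares_bound[of "\<bar>W i \<omega>\<bar>" "\<bar>W j \<omega>\<bar>"] by simp
      moreover have "0 \<le> \<bar>W i \<omega>\<bar> * \<bar>W j \<omega>\<bar>" by simp
      ultimately show "norm (W i \<omega> * W j \<omega>) \<le> norm ((W i \<omega>)\<^sup>2 + (W j \<omega>)\<^sup>2)"
        unfolding real_norm_def abs_mult by linarith
    qed
    show "(\<lambda>\<omega>. W i \<omega> * W j \<omega>) \<in> borel_measurable M"
      using intW that by (auto intro: borel_measurable_times)
  qed
  have cross: "expectation (\<lambda>\<omega>. W i \<omega> * W j \<omega>) = 0" if "i \<in> I" "j \<in> I" "i \<noteq> j" for i j
  proof -
    have "indep_vars (\<lambda>_. borel) W I"
      using indep_vars_compose2[OF indep, of "\<lambda>_ z. z - \<mu>" "\<lambda>_. borel"] by (simp add: W_def)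
    hence "indep_vars (\<lambda>_. borel) W {i, j}" using that by (auto intro: indep_vars_subset)
    hence "expectation (\<lambda>\<omega>. \<Prod>k\<in>{i, j}. W k \<omega>) = (\<Prod>k\<in>{i, j}. expectation (W k))"
      using intW that by (intro indep_vars_lebesgue_integral) auto
    thus ?thesis using that expW by simp
  qed
  \<comment> \<open>The middle term is linear in the centred variables, so its expectation
    vanishes.\<close>
  have expand: "(1 / n * (\<Sum>i\<in>I. Z i \<omega>) - \<theta>)\<^sup>2 =
      1 / n\<^sup>2 * (\<Sum>i\<in>I. \<Sum>j\<in>I. W i \<omega> * W j \<omega>) + 2 * (\<mu> - \<theta>) / n * (\<Sum>i\<in>I. W i \<omega>) + (\<mu> - \<theta>)\<^sup>2" for \<omega>
  proof -
    have "1 / n * (\<Sum>i\<in>I. Z i \<omega>) - \<theta> = 1 / n * (\<Sum>i\<in>I. W i \<omega>) + (\<mu> - \<theta>)"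
      using \<open>n > 0\<close> by (simp add: W_def sum_subtractf n_def field_simps)
    moreover have "(1 / n * S + d)\<^sup>2 = 1 / n\<^sup>2 * (S * S) + 2 * d / n * S + d\<^sup>2" for S d
      using \<open>n > 0\<close> by (simp add: power2_eq_square field_simps)
    ultimately show ?thesis by (simp only: sum_product[symmetric])
  qed
  have int: "integrable M (\<lambda>\<omega>. (1 / n * (\<Sum>i\<in>I. Z i \<omega>) - \<theta>)\<^sup>2)"
    unfolding expand using intWW intW by (intro Bochner_Integration.integrable_add integrable_mult_right
      Bochner_Integration.integrable_sum) auto
  have "expectation (\<lambda>\<omega>. (1 / n * (\<Sum>i\<in>I. Z i \<omega>) - \<theta>)\<^sup>2) =
      1 / n\<^sup>2 * (\<Sum>i\<in>I. \<Sum>j\<in>I. expectation (\<lambda>\<omega>. W i \<omega> * W j \<omega>)) + (\<mu> - \<theta>)\<^sup>2"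
    unfolding expand using intWW intW expW
    by (simp add: Bochner_Integration.integrable_add Bochner_Integration.integral_sum prob_space)
  also have "(\<Sum>i\<in>I. \<Sum>j\<in>I. expectation (\<lambda>\<omega>. W i \<omega> * W j \<omega>)) =
      (\<Sum>i\<in>I. expectation (\<lambda>\<omega>. W i \<omega> * W i \<omega>))"
  proof (rule sum.cong[OF refl])
    fix i assume i: "i \<in> I"
    have "(\<Sum>j\<in>I. expectation (\<lambda>\<omega>. W i \<omega> * W j \<omega>)) =
        (\<Sum>j\<in>I. if j = i then expectation (\<lambda>\<omega>. W i \<omega> * W i \<omega>) else 0)"
      using i cross by (intro sum.cong) auto
    thus "(\<Sum>j\<in>I. expectation (\<lambda>\<omega>. W i \<omega> * W j \<omega>)) = expectation (\<lambda>\<omega>. W i \<omega> * W i \<omega>)"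
      using i I by simp
  qed
  also have "\<dots> \<le> n * B" unfolding n_def by (rule sum_bounded_above) (rule W2)
  finally have "expectation (\<lambda>\<omega>. (1 / n * (\<Sum>i\<in>I. Z i \<omega>) - \<theta>)\<^sup>2) \<le> (\<mu> - \<theta>)\<^sup>2 + B / n"
    using \<open>n > 0\<close> by (simp add: field_simps power2_eq_square)
  thus ?thesis
    using int unfolding n_def by (subst nn_integral_eq_integral) (auto intro: ennreal_leI)
qed

text \<open>The variation bound is parametrised as \<open>V = T\<^sup>m\<^sup>+\<^sup>1\<close>, so that all estimates are polynomial in \<open>T\<close>.\<close>
locale smooth_density =
  fixes p :: "real \<Rightarrow> real" and m :: nat and T :: real
  assumes nonneg: "p x \<ge> 0"
    and prob: "prob_space (density lborel (\<lambda>x. ennreal (p x)))"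
    and m: "m \<ge> 1"
    and diff: "times_differentiable m p"
    and T_nonneg: "T \<ge> 0"
    and tv: "total_variation ((deriv ^^ m) p) \<le> ennreal (T ^ Suc m)"
begin

abbreviation D :: "real measure" where "D \<equiv> density lborel (\<lambda>x. ennreal (p x))"

lemma continuous_density: "continuous_on UNIV p"
  using diff m unfolding times_differentiable_def
  by (auto simp: continuous_on_eq_continuous_at dest!: spec[of _ "0::nat"] differentiable_imp_continuous_within)

lemma density_measurable [measurable]: "p \<in> borel_measurable borel"
  using continuous_density by (rule borel_measurable_continuous_onI)

sublocale real_distribution D
  using prob by (auto simp: real_distribution_def real_distribution_axioms_def)

lemma char_D: "char D = fourier p"
  using nonneg by (simp add: char_density_eq_fourier)

lemma fourier_measurable [measurable]: "fourier p \<in> borel_measurable borel"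
  using char_measurable by (simp add: char_D)

lemma norm_fourier_le_1: "cmod (fourier p t) \<le> 1"
  using cmod_char_le_1 by (simp add: char_D)

lemma fourier_decay: "\<bar>t\<bar> ^ Suc m * cmod (fourier p t) \<le> T ^ Suc m"
proof (rule norm_fourier_decay[OF _ diff tv zero_le_power[OF T_nonneg]])
  show "integrable lborel p"
    using emeasure_space_1 nonneg by (intro integrableI_nonneg) (auto simp: emeasure_density)
qed

text \<open>If \<open>T\<close> were zero, the decay would force \<open>fourier p\<close> to vanish
  away from the origin, against its continuity and value \<open>1\<close> there. Positivity allows
  \<open>T\<close> to be a cut point and a divisor.\<close>

lemma T_pos: "T > 0"
proof (rule ccontr)
  assume "\<not> T > 0"
  hence "T = 0" using T_nonneg by simp
  have "fourier p t = 0" if "t \<noteq> 0" for t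
  proof -
    have "\<bar>t\<bar> ^ Suc m > 0" using that by simp
    thus ?thesis using fourier_decay[of t] \<open>T = 0\<close> by (simp add: mult_le_0_iff not_le[symmetric])
  qed
  hence "fourier p \<midarrow>0\<rightarrow> 0"
    by (intro tendsto_eventually) (auto simp: eventually_at_filter)
  moreover have "fourier p \<midarrow>0\<rightarrow> 1"
    using isCont_char[of 0] char_zero by (simp add: char_D isCont_def)
  ultimately show False using LIM_unique zero_neq_one by blast
qed

text \<open>The cut at \<open>T\<close> is where the bounds \<open>1\<close> and
  \<open>(T / \<bar>t\<bar>) ^ Suc m\<close> meet.\<close>

lemma nn_integral_fourier_le:
  "(\<integral>\<^sup>+t. ennreal (cmod (fourier p t)) \<partial>lborel) \<le> ennreal (2 * (T * (1 + 1 / m)))"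
proof -
  have "(\<integral>\<^sup>+t. ennreal (cmod (fourier p t)) \<partial>lborel) \<le> ennreal (2 * T * 1 + 2 * T ^ Suc m / (m * T ^ m))"
    using norm_fourier_le_1 fourier_decay T_pos m by (intro nn_integral_decay_le) auto
  also have "2 * T * 1 + 2 * T ^ Suc m / (m * T ^ m) = 2 * (T * (1 + 1 / m))"
    using T_pos m by (simp add: field_simps)
  finally show ?thesis .
qed

lemma integrable_fourier_density: "integrable lborel (fourier p)"
  using nn_integral_fourier_le by (intro integrableI_bounded) (auto intro: le_less_trans)

lemma integrable_iexp_fourier: "integrable lborel (\<lambda>t. iexp (- (t * x)) * fourier p t)"
  by (rule Bochner_Integration.integrable_bound[OF integrable_fourier_density]) (auto simp: norm_mult)

lemma inversion: "complex_of_real (p x) = 1 / (2 * pi) * (CLBINT t. iexp (- (t * x)) * fourier p t)"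
  using continuous_density nonneg prob integrable_fourier_density by (rule density_inversion)

lemma density_le: "p x \<le> T * (1 + 1 / m) / pi"
proof -
  have "p x = 1 / (2 * pi) * cmod (CLBINT t. iexp (- (t * x)) * fourier p t)"
    using arg_cong[OF inversion[of x], of cmod] nonneg[of x] by (simp add: norm_mult norm_divide)
  also have "\<dots> \<le> 1 / (2 * pi) * (2 * (T * (1 + 1 / m)))"
    using integrable_iexp_fourier nn_integral_fourier_le T_pos
    by (intro mult_left_mono norm_integral_le) (auto simp: norm_mult)
  finally show ?thesis by simp
qed

text \<open>The remainder \<open>R\<close> is zero inside the window and minus the inversion
  integrand outside. The claim is homogeneous in \<open>T\<close> and \<open>h\<close> except for
  powers of \<open>T * h\<close>, so comparing \<open>T * h\<close> with \<open>1\<close> decides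
  which estimate suffices.\<close>

lemma bias_le:
  assumes "h > 0"
  shows "\<bar>(\<integral>y. 1 / h * sinc_kernel ((x - y) / h) \<partial>D) - p x\<bar> \<le>
    1 / pi * ((real m + 1) / m * T ^ m * h ^ (m - 1))"
proof -
  define b where "b = (\<integral>y. 1 / h * sinc_kernel ((x - y) / h) \<partial>D)"
  define G where "G = (\<lambda>t. iexp (- (t * x)) * fourier p t)"
  define R where "R t = indicator {- 1 / h..1 / h} t *\<^sub>R G t - G t" for t
  have intG: "integrable lborel G"
    unfolding G_def by (rule integrable_iexp_fourier)
  have int1: "integrable lborel (\<lambda>t. indicator {- 1 / h..1 / h} t *\<^sub>R G t)"
    by (rule integrable_mult_indicator[OF _ intG]) simp
  have intR: "integrable lborel R"
    unfolding R_def using int1 intG by (rule Bochner_Integration.integrable_diff)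
  have "complex_of_real (b - p x) = 1 / (2 * pi) * (CLBINT t. R t)"
    unfolding R_def Bochner_Integration.integral_diff[OF int1 intG]
    using integral_sinc_kernel[OF assms, of x] inversion[of x]
    by (simp add: b_def G_def char_D right_diff_distrib)
  from arg_cong[OF this, of cmod] have b: "\<bar>b - p x\<bar> = 1 / (2 * pi) * cmod (CLBINT t. R t)"
    by (simp add: norm_mult norm_divide del: of_real_diff)
  obtain k where k: "m = Suc k" using m by (cases m) auto
  have "cmod (CLBINT t. R t) \<le> 2 * ((real m + 1) / m * T ^ m * h ^ (m - 1))"
  proof (cases "T * h \<ge> 1")
    case True
    have "cmod (R t) \<le> cmod (fourier p t)" for t
      by (auto simp: R_def G_def indicator_def norm_mult)
    hence "(\<integral>\<^sup>+t. ennreal (cmod (R t)) \<partial>lborel) \<le> ennreal (2 * (T * (1 + 1 / m)))"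
      by (intro order_trans[OF nn_integral_mono nn_integral_fourier_le] ennreal_leI)
    hence "cmod (CLBINT t. R t) \<le> 2 * (T * (1 + 1 / m))"
      using intR T_pos by (intro norm_integral_le) auto
    also have "\<dots> = 2 * ((real m + 1) / m * T) * 1"
      using m by (simp add: field_simps)
    \<comment> \<open>The inserted factor is at least \<open>1\<close> and supplies the powers of
      \<open>h\<close> in the claim.\<close>
    also have "\<dots> \<le> 2 * ((real m + 1) / m * T) * (T * h) ^ k"
      using True T_pos by (intro mult_left_mono one_le_power) auto
    also have "\<dots> = 2 * ((real m + 1) / m * T ^ m * h ^ (m - 1))"
      by (simp add: k power_mult_distrib)
    finally show ?thesis .
  next
    case False
    have "(\<integral>\<^sup>+t. ennreal (cmod (R t)) \<partial>lborel) \<le>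
        (\<integral>\<^sup>+t. ennreal (cmod (fourier p t)) * indicator {t. 1 / h \<le> \<bar>t\<bar>} t \<partial>lborel)"
      by (intro nn_integral_mono) (auto simp: R_def G_def indicator_def norm_mult abs_if)
    also have "\<dots> \<le> ennreal (2 * T ^ Suc m / (m * (1 / h) ^ m))"
      using T_pos fourier_decay m assms by (intro nn_integral_decay_tail) auto
    finally have "cmod (CLBINT t. R t) \<le> 2 * T ^ Suc m / (m * (1 / h) ^ m)"
      using intR T_pos assms by (intro norm_integral_le) auto
    also have "\<dots> = 2 * (1 / m * T ^ m * h ^ (m - 1)) * (T * h)"
      by (simp add: k power_divide)
    \<comment> \<open>The tail estimate has a surplus factor \<open>T * h\<close> below
      \<open>1\<close>, which is relaxed to \<open>m + 1\<close> to reach the common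
      constant.\<close>
    also have "\<dots> \<le> 2 * (1 / m * T ^ m * h ^ (m - 1)) * (real m + 1)"
      using False T_pos assms by (intro mult_left_mono) auto
    also have "\<dots> = 2 * ((real m + 1) / m * T ^ m * h ^ (m - 1))"
      by simp
    finally show ?thesis .
  qed
  hence "1 / (2 * pi) * cmod (CLBINT t. R t) \<le> 1 / (2 * pi) * (2 * ((real m + 1) / m * T ^ m * h ^ (m - 1)))"
    by (rule mult_left_mono) simp
  moreover have "1 / (2 * pi) * (2 * s) = 1 / pi * s" for s :: real by simp
  ultimately show ?thesis unfolding b b_def[symmetric] by simp
qed

text \<open>Replace the density by its upper bound and substitute \<open>y = x - h * u\<close>. The
  Jacobian \<open>h\<close> against the prefactor \<open>1 / h\<^sup>2\<close> leaves
  \<open>1 / h\<close>.\<close>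

lemma second_moment_le:
  assumes "h > 0"
  shows "(\<integral>y. (1 / h * sinc_kernel ((x - y) / h))\<^sup>2 \<partial>D) \<le> T * (1 + 1 / m) / pi * (4 / pi\<^sup>2) / h"
proof -
  define P where "P = T * (1 + 1 / m) / pi"
  have "P > 0" using T_pos by (auto simp: P_def intro!: divide_pos_pos mult_pos_pos add_pos_nonneg)
  define g where "g y = 1 / h * sinc_kernel ((x - y) / h)" for y
  have [measurable]: "g \<in> borel_measurable borel" unfolding g_def by measurable
  have "(\<integral>\<^sup>+y. ennreal ((g y)\<^sup>2) \<partial>D) = (\<integral>\<^sup>+y. ennreal (p y) * ennreal ((g y)\<^sup>2) \<partial>lborel)"
    by (subst nn_integral_density) auto
  also have "\<dots> \<le> (\<integral>\<^sup>+y. ennreal P * ennreal ((g y)\<^sup>2) \<partial>lborel)"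
    by (intro nn_integral_mono mult_right_mono ennreal_leI) (use density_le in \<open>auto simp: P_def\<close>)
  also have "\<dots> = ennreal P * (\<integral>\<^sup>+y. ennreal ((g y)\<^sup>2) \<partial>lborel)"
    by (subst nn_integral_cmult) auto
  also have "(\<integral>\<^sup>+y. ennreal ((g y)\<^sup>2) \<partial>lborel) = ennreal h * (\<integral>\<^sup>+u. ennreal ((g (x + - h * u))\<^sup>2) \<partial>lborel)"
    using assms by (subst nn_integral_real_affine[where c="- h" and t=x]) auto
  also have "(\<integral>\<^sup>+u. ennreal ((g (x + - h * u))\<^sup>2) \<partial>lborel) =
      (\<integral>\<^sup>+u. ennreal (1 / h\<^sup>2) * ennreal ((sinc_kernel u)\<^sup>2) \<partial>lborel)"
    using assms by (intro nn_integral_cong) (simp add: g_def power_mult_distrib power_divide flip: ennreal_mult')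
  also have "\<dots> = ennreal (1 / h\<^sup>2) * (\<integral>\<^sup>+u. ennreal ((sinc_kernel u)\<^sup>2) \<partial>lborel)"
    by (subst nn_integral_cmult) auto
  also have "ennreal P * (ennreal h * (ennreal (1 / h\<^sup>2) * (\<integral>\<^sup>+u. ennreal ((sinc_kernel u)\<^sup>2) \<partial>lborel))) \<le>
      ennreal P * (ennreal h * (ennreal (1 / h\<^sup>2) * ennreal (4 / pi\<^sup>2)))"
    by (intro mult_left_mono nn_integral_sinc_kernel_power2_le) auto
  also have "\<dots> = ennreal (P * (4 / pi\<^sup>2) / h)"
    using assms \<open>P > 0\<close> by (simp add: power2_eq_square flip: ennreal_mult)
  finally have nn: "(\<integral>\<^sup>+y. ennreal ((g y)\<^sup>2) \<partial>D) \<le> ennreal (P * (4 / pi\<^sup>2) / h)" .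
  have "integrable D (\<lambda>y. (g y)\<^sup>2)"
    using nn by (intro integrableI_nonneg) (auto intro: le_less_trans)
  hence "norm (\<integral>y. (g y)\<^sup>2 \<partial>D) \<le> P * (4 / pi\<^sup>2) / h"
    using nn \<open>P > 0\<close> assms by (intro norm_integral_le) auto
  thus ?thesis by (simp add: g_def P_def)
qed

end

section \<open>Bias and variance combined at the prescribed bandwidth\<close>

theorem theorem8:
  fixes M :: "'a measure"
    and X :: "nat \<Rightarrow> 'a \<Rightarrow> real"
    and p :: "real \<Rightarrow> real"
    and m n :: nat
    and V h\<^sub>0 h\<^sub>n :: real
  assumes "prob_space M"
    and "n \<ge> 1"
    and "prob_space.indep_vars M (\<lambda>_. borel) X {1..n}"
    and "\<And>x. p x \<ge> 0"
    and "\<And>j. j \<in> {1..n} \<Longrightarrow> distributed M lborel (X j) (\<lambda>x. ennreal (p x))"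
    and "m \<ge> 1"
    and "times_differentiable m p"
    and "V \<ge> 0"
    and "total_variation ((deriv ^^ m) p) = ennreal V"
    and "h\<^sub>0 > 0"
    and "h\<^sub>n = h\<^sub>0 * real n powr (- 1 / (2 * real m - 1))"
  shows "(SUP x. MSE M (sinc_estimator X n h\<^sub>n x) (p x))
    \<le> ennreal (1 / pi\<^sup>2 *
        ((real m + 1)\<^sup>2 / (real m)\<^sup>2 * V powr (2 * real m / (real m + 1)) * h\<^sub>0 ^ (2 * (m - 1))
          + 2 * (V powr (1 / (real m + 1)) + 1 / real m * V powr (real m / (real m + 1))) * (1 / h\<^sub>0))
        * real n powr (- 2 * (real m - 1) / (2 * real m - 1)))"
proof -
  interpret M: prob_space M by fact
  have distr: "distr M lborel (X j) = density lborel (\<lambda>x. ennreal (p x))" if "j \<in> {1..n}" for j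
    using assms(5)[OF that] by (rule distributed_distr_eq_density)
  have [measurable]: "X j \<in> borel_measurable M" if "j \<in> {1..n}" for j
    using distributed_measurable[OF assms(5)[OF that]] by simp
  have "prob_space (distr M lborel (X 1))"
    using \<open>n \<ge> 1\<close> by (intro M.prob_space_distr) simp
  hence prob: "prob_space (density lborel (\<lambda>x. ennreal (p x)))"
    using distr[of 1] \<open>n \<ge> 1\<close> by simp
  define T where "T = V powr (1 / (real m + 1))"
  have "T \<ge> 0" by (simp add: T_def)
  \<comment> \<open>The condition \<open>k \<ge> 1\<close> matters when \<open>V = 0\<close>: there
    \<open>0 powr 0\<close> is \<open>0\<close>, but \<open>T ^ 0\<close> is
    \<open>1\<close>.\<close>
  have powr_V: "V powr (real k / (real m + 1)) = T ^ k" if "k \<ge> 1" for k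
    using \<open>V \<ge> 0\<close> that by (cases "V = 0") (simp_all add: T_def powr_powr zero_power flip: powr_realpow)
  have T_power: "T ^ Suc m = V"
    using powr_V[of "Suc m"] \<open>V \<ge> 0\<close> by (simp add: add.commute)
  have tv: "total_variation ((deriv ^^ m) p) \<le> ennreal (T ^ Suc m)"
    unfolding T_power using assms(9) by simp
  interpret smooth_density p m T
    by (intro smooth_density.intro assms prob \<open>T \<ge> 0\<close> tv)
  define h where "h = h\<^sub>n"
  have "h > 0" using assms by (simp add: h_def)
  define Y where "Y x j \<omega> = 1 / h * sinc_kernel ((x - X j \<omega>) / h)" for x j \<omega>
  define \<beta> where "\<beta> = 1 / pi * ((real m + 1) / m * T ^ m * h ^ (m - 1))"
  define B where "B = T * (1 + 1 / m) / pi * (4 / pi\<^sup>2) / h"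
  have pt: "MSE M (sinc_estimator X n h\<^sub>n x) (p x) \<le> ennreal (\<beta>\<^sup>2 + B / n)" for x
  proof -
    define b where "b = (\<integral>y. 1 / h * sinc_kernel ((x - y) / h) \<partial>D)"
    have transfer: "M.expectation (\<lambda>\<omega>. f (X j \<omega>)) = integral\<^sup>L D f"
      if "j \<in> {1..n}" "f \<in> borel_measurable borel" for j and f :: "real \<Rightarrow> real"
      using that by (subst distr[OF that(1), symmetric]) (simp add: integral_distr)
    have est: "sinc_estimator X n h\<^sub>n x \<omega> = 1 / card {1..n} * (\<Sum>j\<in>{1..n}. Y x j \<omega>)" for \<omega>
      by (simp add: sinc_estimator_def Y_def h_def sum_distrib_left)
    have "MSE M (sinc_estimator X n h\<^sub>n x) (p x) \<le> ennreal ((b - p x)\<^sup>2 + B / card {1..n})"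
      unfolding MSE_def est
    proof (rule M.mean_squared_error_le)
      show "finite {1..n}" "{1..n} \<noteq> {}" using \<open>n \<ge> 1\<close> by auto
      show "M.indep_vars (\<lambda>_. borel) (Y x) {1..n}"
        unfolding Y_def[abs_def] by (rule M.indep_vars_compose2[OF assms(3)]) measurable
      show "\<bar>Y x j \<omega>\<bar> \<le> 1 / h * (1 / pi)" for j \<omega>
        unfolding Y_def abs_mult using \<open>h > 0\<close> by (intro mult_mono abs_sinc_kernel_le) auto
      show "M.expectation (Y x j) = b" if "j \<in> {1..n}" for j
        unfolding Y_def[abs_def] b_def by (rule transfer[OF that]) measurable
      show "M.expectation (\<lambda>\<omega>. (Y x j \<omega>)\<^sup>2) \<le> B" if "j \<in> {1..n}" for j
      proof -
        have "M.expectation (\<lambda>\<omega>. (Y x j \<omega>)\<^sup>2) = (\<integral>y. (1 / h * sinc_kernel ((x - y) / h))\<^sup>2 \<partial>D)"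
          unfolding Y_def by (rule transfer[OF that]) measurable
        also have "\<dots> \<le> B" unfolding B_def by (rule second_moment_le[OF \<open>h > 0\<close>])
        finally show ?thesis .
      qed
    qed
    also have "(b - p x)\<^sup>2 \<le> \<beta>\<^sup>2"
      using bias_le[OF \<open>h > 0\<close>, of x] by (intro power2_le_iff_abs_le[THEN iffD2]) (auto simp: b_def \<beta>_def)
    finally show ?thesis by (simp add: ennreal_leI)
  qed
  define r where "r = real n powr (- 2 * (real m - 1) / (2 * real m - 1))"
  have "2 * real m - 1 > 0" "n > 0" using \<open>m \<ge> 1\<close> \<open>n \<ge> 1\<close> by auto
  \<comment> \<open>The bandwidth exponent balances the two errors: \<open>h ^ (2 * (m - 1))\<close>
    and, below, \<open>1 / (n * h)\<close> are both constants times the rate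
    \<open>r\<close>.\<close>
  have h_power: "h ^ (2 * (m - 1)) = h\<^sub>0 ^ (2 * (m - 1)) * r"
  proof -
    have "- ((2 * real m - 2) / (2 * real m - 1)) = (2 - 2 * real m) / (2 * real m - 1)"
      by (metis minus_diff_eq minus_divide_left)
    hence "(real n powr (- 1 / (2 * real m - 1))) ^ (2 * (m - 1)) = r"
      using \<open>n > 0\<close> \<open>m \<ge> 1\<close> by (simp add: r_def powr_powr of_nat_diff flip: powr_realpow)
    thus ?thesis by (simp add: h_def assms(11) power_mult_distrib)
  qed
  have nh: "1 / (n * h) = 1 / h\<^sub>0 * r"
  proof -
    have "1 + - 1 / (2 * real m - 1) = - (- 2 * (real m - 1) / (2 * real m - 1))"
      using \<open>2 * real m - 1 > 0\<close> by (simp add: field_simps)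
    hence "n * (real n powr (- 1 / (2 * real m - 1))) = real n powr - (- 2 * (real m - 1) / (2 * real m - 1))"
      using \<open>n > 0\<close> by (metis of_nat_0_less_iff powr_add powr_one less_imp_le)
    hence "n * (real n powr (- 1 / (2 * real m - 1))) = 1 / r"
      by (simp add: r_def powr_minus divide_inverse)
    thus ?thesis by (simp add: h_def assms(11) mult.left_commute[of _ h\<^sub>0])
  qed
  have "B / n \<le> 1 / pi\<^sup>2 * (2 * (T + 1 / m * T ^ m)) * (1 / (n * h))"
  proof -
    \<comment> \<open>For \<open>m = 1\<close> both terms on the right equal \<open>T\<close>, and
      \<open>pi \<ge> 2\<close> suffices. For larger \<open>m\<close> the power \<open>T ^ m\<close>
      may be far smaller than \<open>T\<close>, so its term is dropped; then
      \<open>1 + 1 / m \<le> 3 / 2\<close> and \<open>pi > 3\<close> suffice.\<close>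
    have "4 / pi * (T * (1 + 1 / m)) \<le> 2 * (T + 1 / m * T ^ m)"
    proof (cases "m = 1")
      case True
      thus ?thesis using T_pos pi_ge_two by (simp add: field_simps)
    next
      case False
      hence "1 + 1 / m \<le> 3 / 2" using m by (simp add: field_simps)
      hence "4 / pi * (T * (1 + 1 / m)) \<le> 4 / pi * (T * (3 / 2))"
        using T_pos by (intro mult_left_mono) auto
      also have "\<dots> \<le> 2 * T" using T_pos pi_gt3 by (simp add: field_simps)
      also have "\<dots> \<le> 2 * (T + 1 / m * T ^ m)" using T_pos by simp
      finally show ?thesis .
    qed
    hence "1 / pi\<^sup>2 * (4 / pi * (T * (1 + 1 / m))) * (1 / (n * h)) \<le> 1 / pi\<^sup>2 * (2 * (T + 1 / m * T ^ m)) * (1 / (n * h))"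
      using \<open>h > 0\<close> by (intro mult_left_mono mult_right_mono) auto
    thus ?thesis by (simp add: B_def mult_ac)
  qed
  moreover have "\<beta>\<^sup>2 = 1 / pi\<^sup>2 * ((real m + 1)\<^sup>2 / (real m)\<^sup>2 * T ^ (2 * m) * h ^ (2 * (m - 1)))"
    by (simp add: \<beta>_def power_mult_distrib power_divide power_mult[symmetric] mult.commute[of _ 2])
  ultimately have "\<beta>\<^sup>2 + B / n \<le> 1 / pi\<^sup>2 *
      ((real m + 1)\<^sup>2 / (real m)\<^sup>2 * T ^ (2 * m) * h\<^sub>0 ^ (2 * (m - 1)) + 2 * (T + 1 / m * T ^ m) * (1 / h\<^sub>0)) * r"
    unfolding h_power nh by (simp add: algebra_simps)
  moreover have "V powr (2 * real m / (real m + 1)) = T ^ (2 * m)"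
    "V powr (1 / (real m + 1)) = T" "V powr (real m / (real m + 1)) = T ^ m"
    using powr_V[of "2 * m"] powr_V[of m] m by (simp_all add: T_def)
  ultimately show ?thesis
    unfolding r_def by (intro SUP_least order_trans[OF pt] ennreal_leI) simp
qed

end
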